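(* Let $d\ge 3$ be an integer. If $D$ is a sourceless $\vec{K}_{1,d}$-free digraph with $n$ vertices, then $D$ contains a quasi-kernel of order at most $\frac{(d^2-2d+2)n}{d^2-d+1}$.
   Context: Digraphs are finite, without loops and without repeated edges $(u,v)$; both $(u,v)$ and $(v,u)$ may be present. A source is a vertex with in-degree zero; a digraph is sourceless if it has no source. $\vec{K}_{1,d}$ is the orientation of the star $K_{1,d}$ with all edges directed away from the centre (the vertex of degree $d$). A digraph $D$ is $H$-free if $H$ is not an induced subgraph of $D$. $\dist(v,u)$ is the length of a shortest directed path from $v$ to $u$ ($\infty$ if none exists). A quasi-kernel of $D$ is an independent set $Q$ (no edges in either direction between vertices of $Q$) such that for every vertex $u$ of $D$ there is $v\in Q$ with $\dist(v,u)\le 2$. *)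

theory Defs
  imports "Graph_Theory.Graph_Theory"
begin

definition is_source :: "('a, 'b) pre_digraph \<Rightarrow> 'a \<Rightarrow> bool" where
  "is_source D v \<longleftrightarrow> v \<in> verts D \<and> in_degree D v = 0"

definition sourceless :: "('a, 'b) pre_digraph \<Rightarrow> bool" where
  "sourceless D \<longleftrightarrow> \<not> (\<exists>v. is_source D v)"

(* centre 0, leaves 1, ..., d *)
definition out_star :: "nat \<Rightarrow> (nat, nat \<times> nat) pre_digraph" where
  "out_star d = \<lparr> verts = {0..d}, arcs = {0} \<times> {1..d}, tail = fst, head = snd \<rparr>"

definition induced_free :: "('c, 'd) pre_digraph \<Rightarrow> ('a, 'b) pre_digraph \<Rightarrow> bool" where
  "induced_free H D \<longleftrightarrow> \<not> (\<exists>S. induced_subgraph S D \<and> digraph_iso S H)"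

(* Every arc has cost 1, so the cost of a walk is its length.  The library's infimum ranges
   over walks; a shortest walk is a path, and the infimum is \<infinity> if there is no walk. *)
definition digraph_dist :: "('a, 'b) pre_digraph \<Rightarrow> 'a \<Rightarrow> 'a \<Rightarrow> ereal" where
  "digraph_dist D u v = wf_digraph.\<mu> D (\<lambda>_. 1) u v"

definition independent_set :: "('a, 'b) pre_digraph \<Rightarrow> 'a set \<Rightarrow> bool" where
  "independent_set D Q \<longleftrightarrow> Q \<subseteq> verts D \<and> (\<forall>u\<in>Q. \<forall>v\<in>Q. \<not> u \<rightarrow>\<^bsub>D\<^esub> v)"

definition quasi_kernel :: "('a, 'b) pre_digraph \<Rightarrow> 'a set \<Rightarrow> bool" where
  "quasi_kernel D Q \<longleftrightarrow> independent_set D Q \<and> (\<forall>u\<in>verts D. \<exists>v\<in>Q. digraph_dist D v u \<le> 2)"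

end

theory Submission
  imports Defs
begin

text \<open>Start from any quasi-kernel \<open>Q\<close>, let \<open>N\<close> be its out-neighbourhood and \<open>M\<close> the remaining
  vertices. Shrink \<open>Q\<close> to a minimal \<open>Q'\<close> with the same out-neighbourhood \<open>N\<close>; by minimality every
  vertex of \<open>Q'\<close> has a private out-neighbour, so \<open>|Q'| \<le> |N|\<close>. A vertex of \<open>Q\<close> with an in-neighbour
  in \<open>N\<close> is still within distance two of \<open>Q'\<close>, so it suffices to add back the set \<open>B\<close> of those whose
  in-neighbours all lie in \<open>M\<close>. Vertices of \<open>M\<close> have no in-neighbour in \<open>Q\<close>, hence the out-neighbours
  in \<open>B\<close> of such a vertex form an induced out-star with it, and \<open>|B| \<le> (d - 1) |M|\<close>. Altogether the
  quasi-kernel \<open>Q' \<union> B\<close> has at most \<open>(d - 1) n / d\<close> elements, which is below the required bound.\<close>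

text \<open>Stated for a bare relation, so that the combinatorial lemmas can ignore arcs and
  walks.\<close>

definition within_two :: "('a \<Rightarrow> 'a \<Rightarrow> bool) \<Rightarrow> 'a \<Rightarrow> 'a \<Rightarrow> bool" where
  "within_two E q u \<longleftrightarrow> q = u \<or> E q u \<or> (\<exists>w. E q w \<and> E w u)"

text \<open>The Chvatal-Lovasz theorem. Delete a vertex \<open>v\<close> with its out-neighbours and
  take \<open>Q\<close> for the rest by induction. If some member of \<open>Q\<close> has an edge to
  \<open>v\<close>, it reaches the out-neighbours of \<open>v\<close> in two steps and
  \<open>Q\<close> suffices; otherwise \<open>v\<close> can join \<open>Q\<close>, since its
  out-neighbours were deleted.\<close>

lemma quasi_kernel_exists:
  assumes "finite V" and irrefl: "\<And>v. \<not> E v v"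
  shows "\<exists>Q\<subseteq>V. (\<forall>x\<in>Q. \<forall>y\<in>Q. \<not> E x y) \<and> (\<forall>u\<in>V. \<exists>q\<in>Q. within_two E q u)"
  using assms(1)
proof (induction V rule: finite_psubset_induct)
  case (psubset V)
  show ?case
  proof (cases "V = {}")
    case False
    then obtain v where v: "v \<in> V" by blast
    let ?W = "{u \<in> V. u \<noteq> v \<and> \<not> E v u}"
    have "?W \<subset> V" using v by blast
    from psubset.IH[OF this] obtain Q where Q: "Q \<subseteq> ?W" "\<forall>x\<in>Q. \<forall>y\<in>Q. \<not> E x y"
      and reach: "\<forall>u\<in>?W. \<exists>q\<in>Q. within_two E q u"
      by (elim exE conjE)
    show ?thesis
    proof (cases "\<exists>q\<in>Q. E q v")
      case True
      then have "\<forall>u\<in>V. \<exists>q\<in>Q. within_two E q u"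
        using reach unfolding within_two_def by blast
      then show ?thesis using Q by blast
    next
      case False
      let ?Q = "insert v Q"
      have "\<forall>x\<in>?Q. \<forall>y\<in>?Q. \<not> E x y" using False Q irrefl by blast
      moreover have "\<forall>u\<in>V. \<exists>q\<in>?Q. within_two E q u"
        using reach unfolding within_two_def by blast
      moreover have "?Q \<subseteq> V" using Q v by blast
      ultimately show ?thesis by blast
    qed
  qed auto
qed

lemma minimal_dominating_subset:
  assumes "finite Q" "finite N" "\<forall>w\<in>N. \<exists>q\<in>Q. E q w"
  shows "\<exists>Q'\<subseteq>Q. (\<forall>w\<in>N. \<exists>q\<in>Q'. E q w) \<and> card Q' \<le> card N"
  using assms(1,3)
proof (induction Q rule: finite_psubset_induct)
  case (psubset Q)
  show ?case
  proof (cases "\<exists>p\<in>Q. \<forall>w\<in>N. \<exists>q\<in>Q - {p}. E q w")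
    case True
    then obtain p where p: "p \<in> Q" "\<forall>w\<in>N. \<exists>q\<in>Q - {p}. E q w" by blast
    have "Q - {p} \<subset> Q" using p(1) by blast
    from psubset.IH[OF this p(2)] show ?thesis by blast
  next
    case False
    then have "\<forall>p\<in>Q. \<exists>w\<in>N. \<forall>q\<in>Q. E q w \<longrightarrow> q = p" by blast
    then obtain f where f: "\<And>p. p \<in> Q \<Longrightarrow> f p \<in> N"
      "\<And>p q. p \<in> Q \<Longrightarrow> q \<in> Q \<Longrightarrow> E q (f p) \<Longrightarrow> q = p"
      by metis
    \<comment> \<open>Some member of \<open>Q\<close> dominates \<open>f p\<close>, and by privacy
      it can only be \<open>p\<close>. So \<open>f p = f q\<close> makes both \<open>p\<close> and
      \<open>q\<close> dominate one private vertex.\<close>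
    have "inj_on f Q"
      by (rule inj_onI) (metis f psubset.prems)
    then have "card Q \<le> card N"
      using f(1) assms(2) by (intro card_inj_on_le[of f]) auto
    then show ?thesis using psubset.prems by blast
  qed
qed

text \<open>The hypothesis \<open>star\<close> is star-freeness in terms of edges, used with
  \<open>c = d - 1\<close>. The conclusion encodes the ratio c/(c + 1) without division; the
  subtraction is not truncated because \<open>Q\<close> is a subset of the finite set
  \<open>V\<close>.\<close>

lemma small_quasi_kernel:
  fixes E :: "'a \<Rightarrow> 'a \<Rightarrow> bool"
  assumes fin: "finite V" and irrefl: "\<And>v. \<not> E v v"
    and closed: "\<And>u v. E u v \<Longrightarrow> u \<in> V \<and> v \<in> V"
    and sourceless: "\<And>v. v \<in> V \<Longrightarrow> \<exists>u. E u v"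
    and star: "\<And>u T. \<lbrakk>finite T; \<And>x. x \<in> T \<Longrightarrow> E u x; \<And>x. x \<in> T \<Longrightarrow> \<not> E x u;
      \<And>x y. x \<in> T \<Longrightarrow> y \<in> T \<Longrightarrow> \<not> E x y\<rbrakk> \<Longrightarrow> card T \<le> c"
    and "c \<ge> 1"
  shows "\<exists>Q\<subseteq>V. (\<forall>x\<in>Q. \<forall>y\<in>Q. \<not> E x y) \<and> (\<forall>u\<in>V. \<exists>q\<in>Q. within_two E q u) \<and>
    card Q \<le> c * (card V - card Q)"
proof -
  obtain Q where Q: "Q \<subseteq> V" and indep: "\<And>x y. x \<in> Q \<Longrightarrow> y \<in> Q \<Longrightarrow> \<not> E x y"
    and reach: "\<And>u. u \<in> V \<Longrightarrow> \<exists>q\<in>Q. within_two E q u"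
    using quasi_kernel_exists[of V E, OF fin irrefl] by metis
  define N where "N = {w. \<exists>q\<in>Q. E q w}"
  define M where "M = V - Q - N"
  define B where "B = {q \<in> Q. \<forall>w\<in>N. \<not> E w q}"
  have NV: "N \<subseteq> V - Q" using closed indep by (auto simp: N_def)
  have fins: "finite Q" "finite N" "finite M" "finite B"
    using fin Q NV by (auto simp: M_def B_def intro: finite_subset)
  obtain Q' where Q': "Q' \<subseteq> Q" "card Q' \<le> card N" and dom: "\<And>w. w \<in> N \<Longrightarrow> \<exists>q\<in>Q'. E q w"
  proof -
    have "\<forall>w\<in>N. \<exists>q\<in>Q. E q w" by (simp add: N_def)
    from minimal_dominating_subset[OF fins(1,2) this] show thesis
      by (elim exE conjE) (rule that, assumption+, erule (1) bspec)
  qed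
  let ?R = "Q' \<union> B"
  have RQ: "?R \<subseteq> Q" using Q' by (auto simp: B_def)
  have "within_two E q u" if "q \<in> Q'" "E q w" "E w u" for q w u
    using that by (auto simp: within_two_def)
  \<comment> \<open>Whatever was reached from \<open>Q\<close> through a vertex of \<open>N\<close>
    stays reachable after shrinking, as \<open>Q'\<close> still dominates \<open>N\<close>.\<close>
  then have via: "\<exists>q\<in>?R. within_two E q u" if "w \<in> N" "E w u" for w u
    using dom that by blast
  have reachR: "\<exists>q\<in>?R. within_two E q u" if u: "u \<in> V" for u
  proof (cases "u \<in> Q")
    case True
    show ?thesis
    proof (cases "u \<in> B")
      case True
      then show ?thesis by (auto simp: within_two_def)
    next
      case False
      with \<open>u \<in> Q\<close> show ?thesis using via by (auto simp: B_def)
    qed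
  next
    case False
    obtain q where q: "q \<in> Q" "within_two E q u" using reach u by blast
    show ?thesis
    proof (cases "u \<in> N")
      case True
      then show ?thesis using dom by (auto simp: within_two_def)
    next
      case uN: False
      then obtain w where "E q w" "E w u"
        using q \<open>u \<notin> Q\<close> by (auto simp: within_two_def N_def)
      then show ?thesis using via q(1) by (auto simp: N_def)
    qed
  qed
  have "B \<subseteq> (\<Union>m\<in>M. {x \<in> B. E m x})"
  proof
    fix x assume x: "x \<in> B"
    then have "x \<in> V" using Q by (auto simp: B_def)
    from sourceless[OF this] obtain m where m: "E m x" ..
    \<comment> \<open>Independence of \<open>Q\<close> keeps \<open>m\<close> out of
      \<open>Q\<close>, and the definition of \<open>B\<close> keeps it out of
      \<open>N\<close>.\<close>
    then have "m \<in> M" using x closed indep by (auto simp: M_def B_def)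
    then show "x \<in> (\<Union>m\<in>M. {x \<in> B. E m x})" using m x by blast
  qed
  then have "card B \<le> card (\<Union>m\<in>M. {x \<in> B. E m x})"
    using fins by (intro card_mono) auto
  also have "\<dots> \<le> (\<Sum>m\<in>M. card {x \<in> B. E m x})" using fins by (intro card_UN_le)
  also have "\<dots> \<le> (\<Sum>m\<in>M. c)"
  proof (rule sum_mono)
    fix m assume "m \<in> M"
    \<comment> \<open>There are no back edges to \<open>m\<close>: it lies outside \<open>N\<close>,
      while \<open>B\<close> is part of \<open>Q\<close>.\<close>
    then show "card {x \<in> B. E m x} \<le> c"
      using fins indep by (intro star[of _ m]) (auto simp: M_def N_def B_def)
  qed
  finally have B: "card B \<le> c * card M" by (simp add: mult.commute)
  have "card ?R \<le> card Q' + card B" by (rule card_Un_le)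
  \<comment> \<open>Since \<open>c\<close> is at least 1, the weaker bound for \<open>Q'\<close>
    gets the same factor as the one for \<open>B\<close>, so that \<open>N\<close> and
    \<open>M\<close> can be merged.\<close>
  also have "\<dots> \<le> c * card N + c * card M"
    using Q'(2) B mult_le_mono[OF \<open>c \<ge> 1\<close>, of "card N" "card N"] by linarith
  also have "\<dots> = c * card (N \<union> M)"
    using fins by (subst card_Un_disjoint) (auto simp: M_def distrib_left)
  also have "N \<union> M = V - Q" using NV by (auto simp: M_def)
  also have "c * card (V - Q) \<le> c * (card V - card ?R)"
    using fins Q RQ card_mono[OF fins(1) RQ] by (simp add: card_Diff_subset diff_le_mono2)
  finally have "card ?R \<le> c * (card V - card ?R)" .
  then show ?thesis using RQ Q indep reachR by (intro exI[of _ ?R]) blast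
qed

text \<open>The isomorphism labels \<open>u\<close> by 0 and \<open>T\<close> by 1, ..., d. As the
  arcs of \<open>out_star\<close> are pairs, each arc goes to the pair of labels of its
  ends.\<close>

lemma induced_out_star:
  assumes "digraph D" "u \<in> verts D" "T \<subseteq> verts D" "card T = d" "finite T"
    and out_arc: "\<And>x. x \<in> T \<Longrightarrow> u \<rightarrow>\<^bsub>D\<^esub> x" and back_arc: "\<And>x. x \<in> T \<Longrightarrow> \<not> x \<rightarrow>\<^bsub>D\<^esub> u"
    and indep: "\<And>x y. x \<in> T \<Longrightarrow> y \<in> T \<Longrightarrow> \<not> x \<rightarrow>\<^bsub>D\<^esub> y"
  shows "\<not> induced_free (out_star d) D"
proof -
  interpret digraph D by fact
  define S where "S = D \<restriction> (insert u T)"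
  have ind: "induced_subgraph S D"
    unfolding S_def using assms by (intro induced_induce) auto
  have uT: "u \<notin> T" using out_arc back_arc by blast
  obtain g where g: "bij_betw g T {1..d}"
    using assms(4,5) by (metis finite_same_card_bij finite_atLeastAtMost card_atLeastAtMost diff_Suc_1)
  define f where "f x = (if x = u then 0 else g x)" for x
  have fT: "f ` T = {1..d}" using g uT by (auto simp: f_def bij_betw_def)
  have f: "bij_betw f (insert u T) {0..d}"
  proof -
    have "bij_betw f T {1..d}"
      using g uT by (subst bij_betw_cong[of T f g]) (auto simp: f_def)
    then have "bij_betw f (insert u T) (insert (f u) {1..d})"
      using notIn_Un_bij_betw[of u T f "{1..d}"] uT by (simp add: f_def)
    moreover have "insert (f u) {1..d} = {0..d}" by (auto simp: f_def)
    ultimately show ?thesis by simp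
  qed
  define h where "h = \<lparr>iso_verts = f, iso_arcs = (\<lambda>e. (f (tail D e), f (head D e))),
    iso_head = snd, iso_tail = fst\<rparr>"
  \<comment> \<open>Arcs inside \<open>T\<close>, arcs back to \<open>u\<close> and loops at
    \<open>u\<close> are all excluded, which leaves only the rays of the star.\<close>
  have arcsS: "e \<in> arcs S \<longleftrightarrow> e \<in> arcs D \<and> tail D e = u \<and> head D e \<in> T" for e
  proof -
    have "e \<in> arcs D \<Longrightarrow> tail D e \<rightarrow>\<^bsub>D\<^esub> head D e" by (rule in_arcs_imp_in_arcs_ends)
    then show ?thesis
      unfolding S_def using indep back_arc uT no_loops[of e] by auto
  qed
  have "pre_digraph.digraph_isomorphism S h"
    unfolding pre_digraph.digraph_isomorphism_def
  proof (intro conjI ballI)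
    show "wf_digraph S" unfolding S_def by blast
    show "inj_on (iso_verts h) (verts S)"
      using f by (simp add: S_def h_def bij_betw_def)
    show "inj_on (iso_arcs h) (arcs S)"
    proof (rule inj_onI)
      fix a b assume ab: "a \<in> arcs S" "b \<in> arcs S" "iso_arcs h a = iso_arcs h b"
      \<comment> \<open>All arcs of \<open>S\<close> have tail \<open>u\<close>, so equal heads make
        them parallel.\<close>
      then have "head D a = head D b"
        using f by (auto simp: h_def arcsS bij_betw_def inj_on_def)
      then show "a = b"
        using ab no_multi_arcs[of a b] by (auto simp: arcsS arc_to_ends_def)
    qed
  qed (auto simp: h_def S_def)
  moreover have "out_star d = app_iso h S"
  proof (rule pre_digraph.equality)
    show "verts (out_star d) = verts (app_iso h S)"
      using f by (simp add: out_star_def h_def S_def bij_betw_def)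
    have "iso_arcs h ` arcs S = {0} \<times> f ` T"
    proof (intro equalityI subsetI)
      fix p :: "nat \<times> nat" assume "p \<in> {0} \<times> f ` T"
      then obtain x where x: "x \<in> T" "p = (0, f x)" by auto
      then obtain e where "e \<in> arcs D" "tail D e = u" "head D e = x"
        using out_arc by (auto simp: arcs_ends_conv)
      then show "p \<in> iso_arcs h ` arcs S"
        using x by (auto simp: h_def arcsS f_def intro!: rev_image_eqI[of e])
    qed (auto simp: h_def arcsS f_def)
    then show "arcs (out_star d) = arcs (app_iso h S)"
      using fT by (simp add: out_star_def)
  qed (simp_all add: out_star_def h_def)
  ultimately show ?thesis
    using ind unfolding induced_free_def digraph_iso_def by blast
qed

text \<open>The distance is an infimum over walks, so one explicit walk with at most two arcs bounds
  it.\<close>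

lemma digraph_dist_le_two:
  assumes "wf_digraph D" "u \<in> verts D" "within_two (dominates D) q u"
  shows "digraph_dist D q u \<le> 2"
proof -
  interpret wf_digraph D by fact
  consider "q = u" | "q \<rightarrow>\<^bsub>D\<^esub> u" | w where "q \<rightarrow>\<^bsub>D\<^esub> w" "w \<rightarrow>\<^bsub>D\<^esub> u"
    using assms(3) by (auto simp: within_two_def)
  then have "\<exists>p. awalk q p u \<and> length p \<le> 2"
  proof cases
    case 1
    then show ?thesis using assms(2) by (intro exI[of _ "[]"]) (simp add: awalk_Nil_iff)
  next
    case 2
    then obtain e where "e \<in> arcs D" "tail D e = q" "head D e = u"
      by (auto simp: arcs_ends_conv)
    then show ?thesis by (intro exI[of _ "[e]"]) (auto simp: awalk_simps)
  next
    case 3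
    then obtain a b where "a \<in> arcs D" "tail D a = q" "head D a = w"
      "b \<in> arcs D" "tail D b = w" "head D b = u"
      by (auto simp: arcs_ends_conv)
    then show ?thesis by (intro exI[of _ "[a, b]"]) (auto simp: awalk_simps)
  qed
  then obtain p where p: "awalk q p u" "length p \<le> 2" by blast
  have "\<mu> (\<lambda>_. 1) q u \<le> ereal (awalk_cost (\<lambda>_. 1) p)"
    by (rule min_cost_le_walk_cost[OF p(1)])
  also have "\<dots> \<le> ereal 2"
    using p(2) by (simp add: awalk_cost_def sum_list_triv)
  finally show ?thesis by (simp add: digraph_dist_def)
qed

theorem corollary1p3:
  fixes D :: "('a, 'b) pre_digraph" and d n :: nat
  assumes "d \<ge> 3"
    and "digraph D"
    and "sourceless D"
    and "induced_free (out_star d) D"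
    and "n = card (verts D)"
  shows "\<exists>Q. quasi_kernel D Q \<and>
    real (card Q) \<le> (real d ^ 2 - 2 * real d + 2) * real n / (real d ^ 2 - real d + 1)"
proof -
  interpret digraph D by fact
  have "\<exists>Q\<subseteq>verts D. (\<forall>x\<in>Q. \<forall>y\<in>Q. \<not> x \<rightarrow>\<^bsub>D\<^esub> y) \<and>
    (\<forall>u\<in>verts D. \<exists>q\<in>Q. within_two (dominates D) q u) \<and>
    card Q \<le> (d - 1) * (card (verts D) - card Q)"
  proof (rule small_quasi_kernel)
    show "\<not> v \<rightarrow>\<^bsub>D\<^esub> v" for v using no_loops by (auto simp: arcs_ends_conv)
    show "\<exists>u. u \<rightarrow>\<^bsub>D\<^esub> v" if "v \<in> verts D" for v
    proof -
      have "in_arcs D v \<noteq> {}"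
        using that \<open>sourceless D\<close> by (auto simp: sourceless_def is_source_def in_degree_def)
      then show ?thesis by (force simp: arcs_ends_conv)
    qed
    show "card T \<le> d - 1"
      if T: "finite T" "\<And>x. x \<in> T \<Longrightarrow> u \<rightarrow>\<^bsub>D\<^esub> x" "\<And>x. x \<in> T \<Longrightarrow> \<not> x \<rightarrow>\<^bsub>D\<^esub> u"
        "\<And>x y. x \<in> T \<Longrightarrow> y \<in> T \<Longrightarrow> \<not> x \<rightarrow>\<^bsub>D\<^esub> y" for u T
    proof (rule ccontr)
      assume "\<not> card T \<le> d - 1"
      then have "d \<le> card T" by simp
      then obtain T' where T': "T' \<subseteq> T" "card T' = d" "finite T'"
        by (rule obtain_subset_with_card_n)
      \<comment> \<open>A leaf is needed to see that \<open>u\<close> is a vertex of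
        \<open>D\<close>: here \<open>u\<close> is known only through its edges.\<close>
      then obtain x where "x \<in> T'" using \<open>d \<ge> 3\<close> by fastforce
      then have "x \<in> T" using T'(1) by blast
      then have "u \<in> verts D" using T(2) adj_in_verts(1) by metis
      moreover have "T' \<subseteq> verts D"
        using T'(1) adj_in_verts(2)[OF T(2)] by (meson subset_iff)
      ultimately have "\<not> induced_free (out_star d) D"
        using T T' \<open>digraph D\<close> by (intro induced_out_star[where u = u and T = T']) (auto simp: subset_iff)
      then show False using assms(4) by blast
    qed
  qed (use \<open>d \<ge> 3\<close> in auto)
  then obtain Q where Q: "Q \<subseteq> verts D" "\<forall>x\<in>Q. \<forall>y\<in>Q. \<not> x \<rightarrow>\<^bsub>D\<^esub> y"
    "\<forall>u\<in>verts D. \<exists>q\<in>Q. within_two (dominates D) q u"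
    and card: "card Q \<le> (d - 1) * (n - card Q)"
    using assms(5) by blast
  have "quasi_kernel D Q"
    unfolding quasi_kernel_def independent_set_def
    using Q digraph_dist_le_two[OF wf_digraph_axioms] by blast
  moreover have "real (card Q) \<le> (real d ^ 2 - 2 * real d + 2) * real n / (real d ^ 2 - real d + 1)"
  proof -
    \<comment> \<open>This makes the natural-number subtraction in \<open>card\<close> agree with
      the real one.\<close>
    have "card Q \<le> n" using Q(1) assms(5) by (simp add: card_mono)
    then have "real (card Q) \<le> (real d - 1) * (real n - real (card Q))"
      using \<open>d \<ge> 3\<close> of_nat_mono[OF card, where 'a = real]
      by (simp only: of_nat_mult of_nat_diff of_nat_1)
    then have "real d * real (card Q) \<le> (real d - 1) * real n" by (simp add: algebra_simps)
    \<comment> \<open>The ratio (d - 1)/d is compared with the required one by cross-multiplication: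
      (d^2 - d + 1)(d - 1) = d(d^2 - 2d + 2) - 1, so the slack is exactly \<open>n\<close>.\<close>
    then have "(real d ^ 2 - real d + 1) * (real d * real (card Q)) \<le>
        (real d ^ 2 - real d + 1) * ((real d - 1) * real n)"
      using \<open>d \<ge> 3\<close> by (intro mult_left_mono) (auto simp: power2_eq_square)
    also have "\<dots> = real d * ((real d ^ 2 - 2 * real d + 2) * real n) - real n"
      by (simp add: algebra_simps power2_eq_square)
    also have "\<dots> \<le> real d * ((real d ^ 2 - 2 * real d + 2) * real n)" by simp
    finally have "real d * (real (card Q) * (real d ^ 2 - real d + 1)) \<le>
        real d * ((real d ^ 2 - 2 * real d + 2) * real n)"
      by (simp add: mult_ac)
    then have "real (card Q) * (real d ^ 2 - real d + 1) \<le> (real d ^ 2 - 2 * real d + 2) * real n"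
      using \<open>d \<ge> 3\<close> by (subst (asm) mult_le_cancel_left_pos) auto
    moreover have "real d ^ 2 - real d + 1 > 0"
      using \<open>d \<ge> 3\<close> by (simp add: power2_eq_square add_nonneg_pos)
    ultimately show ?thesis by (simp add: pos_le_divide_eq)
  qed
  ultimately show ?thesis by blast
qed

end
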